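(* Let $B$ be a content $S$-semialgebra over a semiring $S$, with content function $c$. Then the following statements hold: (1) if $B$ is primal, then $S$ is primal and $Z(B)=Z(S)B$; (2) if $S$ is primal and has Property (A), then $B$ is primal, has Property (A), and $Z(B)=Z(S)B$; (3) if the content function $c:B\to\operatorname{FId}(S)$ is onto, then $B$ is primal if and only if $S$ is primal and has Property (A).
   Context: A semiring $(S,+,\cdot,0,1)$ is commutative: $(S,+,0)$ and $(S,\cdot,1)$ are commutative monoids, $1\neq 0$, multiplication distributes over addition, and $s\cdot 0=0$ for all $s$. An ideal is a nonempty subset closed under addition and under multiplication by elements of $S$; $\operatorname{Id}(S)$ and $\operatorname{FId}(S)$ are the sets of ideals and of finitely generated ideals of $S$. $Z(S)$ is the set of zero-divisors: $s\in S$ with $ss'=0$ for some $s'\neq 0$ in $S$. $S$ is primal if $Z(S)$ is an ideal of $S$. $S$ has Property (A) if each finitely generated ideal $I\subseteq Z(S)$ has a nonzero annihilator, i.e. there is $s\neq 0$ in $S$ with $sI=0$. An $S$-semialgebra is a semiring $B$ with a semiring homomorphism $\lambda:S\to B$ (preserving $+,\cdot,0,1$), with scalar product $sf=\lambda(s)f$; for an ideal $I$ of $S$, $IB=\{\sum_{i=1}^n a_if_i:a_i\in I,f_i\in B\}$. $B$ is a content $S$-semialgebra if $\lambda$ is injective (so $S\subseteq B$) and there is a function $c:B\to\operatorname{Id}(S)$ (the content function) such that: (i) for all $f\in B$ and all ideals $I$ of $S$, $f\in IB$ iff $c(f)\subseteq I$; (ii) $c(sf)=s\,c(f)$ for all $s\in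 S$, $f\in B$, and $c(1)=S$; (iii) for all $f,g\in B$ there is an integer $m\ge 0$ with $c(f)^{m+1}c(g)=c(f)^mc(fg)$. Products of ideals are sets of finite sums of products, and $I^0=S$. The function $c$ is uniquely determined, $c(f)=\bigcap\{I\in\operatorname{Id}(S): f\in IB\}$, and its values are finitely generated ideals. *)

theory Defs
  imports Main "HOL.Hull"
begin

text \<open>
  A semiring here is a type of class \<^class>\<open>comm_semiring_1\<close>, which includes \<open>0 \<noteq> 1\<close> and
  \<open>0 * a = 0\<close>. Notions that depend only on the semiring take it as a type argument.
\<close>

definition semiring_ideal :: "'a::comm_semiring_1 set \<Rightarrow> bool" where
  "semiring_ideal I \<longleftrightarrow>
     I \<noteq> {} \<and> (\<forall>a\<in>I. \<forall>b\<in>I. a + b \<in> I) \<and> (\<forall>s. \<forall>a\<in>I. s * a \<in> I)"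

definition Id_set :: "'a::comm_semiring_1 set set" where
  "Id_set = {I. semiring_ideal I}"

definition FId_set :: "'a::comm_semiring_1 set set" where
  "FId_set = {semiring_ideal hull A | A. finite A}"

definition zero_divisors :: "'a::comm_semiring_1 set" where
  "zero_divisors = {s. \<exists>t. t \<noteq> 0 \<and> s * t = 0}"

definition primal :: "'a::comm_semiring_1 itself \<Rightarrow> bool" where
  "primal _ \<longleftrightarrow> semiring_ideal (zero_divisors :: 'a set)"

definition property_A :: "'a::comm_semiring_1 itself \<Rightarrow> bool" where
  "property_A _ \<longleftrightarrow>
     (\<forall>I \<in> (FId_set :: 'a set set). I \<subseteq> zero_divisors \<longrightarrow> (\<exists>s. s \<noteq> 0 \<and> (\<forall>a\<in>I. s * a = 0)))"

definition ideal_prod :: "'a::comm_semiring_1 set \<Rightarrow> 'a set \<Rightarrow> 'a set" where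
  "ideal_prod I J =
     {(\<Sum>i<n. a i * b i) | (n::nat) a b. (\<forall>i<n. a i \<in> I) \<and> (\<forall>i<n. b i \<in> J)}"

primrec ideal_power :: "'a::comm_semiring_1 set \<Rightarrow> nat \<Rightarrow> 'a set" where
  "ideal_power I 0 = UNIV"
| "ideal_power I (Suc n) = ideal_prod I (ideal_power I n)"

text \<open>
  An \<open>S\<close>-semialgebra \<open>B\<close> is given by its structure map \<open>lam\<close> from \<open>S\<close> to \<open>B\<close>; the scalar
  product of \<open>s\<close> and \<open>f\<close> is \<open>lam s * f\<close>.
\<close>

locale semialgebra =
  fixes lam :: "'a::comm_semiring_1 \<Rightarrow> 'b::comm_semiring_1"
  assumes lam_zero: "lam 0 = 0"
    and lam_one: "lam 1 = 1"
    and lam_add: "lam (s + t) = lam s + lam t"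
    and lam_mult: "lam (s * t) = lam s * lam t"

text \<open>The set \<open>IB\<close>; the empty sum only contributes \<open>0\<close>.\<close>

definition ideal_ext :: "('a::comm_semiring_1 \<Rightarrow> 'b::comm_semiring_1) \<Rightarrow> 'a set \<Rightarrow> 'b set" where
  "ideal_ext lam I = {(\<Sum>i<n. lam (a i) * f i) | (n::nat) a f. \<forall>i<n. a i \<in> I}"

locale content_semialgebra = semialgebra lam
  for lam :: "'a::comm_semiring_1 \<Rightarrow> 'b::comm_semiring_1" +
  fixes c :: "'b \<Rightarrow> 'a set"
  assumes lam_inj: "inj lam"
    and content_ideal: "c f \<in> Id_set"
    and content_iff: "I \<in> Id_set \<Longrightarrow> f \<in> ideal_ext lam I \<longleftrightarrow> c f \<subseteq> I"
    and content_scale: "c (lam s * f) = (\<lambda>a. s * a) ` c f"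
    and content_one: "c 1 = UNIV"
    and dedekind_mertens:
      "\<exists>m. ideal_prod (ideal_power (c f) (m + 1)) (c g)
           = ideal_prod (ideal_power (c f) m) (c (f * g))"

end

theory Submission
  imports Defs
begin

text \<open>
  Everything rests on a McCoy theorem for content semialgebras: an element \<open>f\<close> of \<open>B\<close> is a
  zero-divisor if and only if a single nonzero scalar \<open>s\<close> of \<open>S\<close> kills it, which by
  \<open>c (s f) = s c f\<close> means that \<open>s\<close> annihilates the ideal \<open>c f\<close>
  (\<open>zero_divisor_iff_content_annihilated\<close>). If \<open>f g = 0\<close> with \<open>g \<noteq> 0\<close>, the Dedekind--Mertens
  condition gives \<open>c(f)\<^sup>k c(g) = 0\<close> for some \<open>k\<close>; since \<open>c(g) \<noteq> 0\<close>, there is a last power of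
  \<open>c(f)\<close> whose product with \<open>c(g)\<close> is nonzero, and any nonzero element of that product kills
  \<open>c(f)\<close>.

  Consequently the content of a zero-divisor lies in \<open>Z(S)\<close>. As soon as \<open>Z(S)\<close> is an ideal, the
  defining property of the content turns \<open>c f \<subseteq> Z(S)\<close> into \<open>f \<in> Z(S)B\<close>, hence
  \<open>Z(B) \<subseteq> Z(S)B\<close>. The reverse inclusion has two sources. If \<open>B\<close> is primal it holds because
  the injective structure map sends \<open>Z(S)\<close> into the ideal \<open>Z(B)\<close>. If instead \<open>S\<close> has
  Property (A), it holds because contents are finitely generated, so that \<open>c f \<subseteq> Z(S)\<close> already
  forces a nonzero annihilator of \<open>c f\<close>. In the latter case finitely many zero-divisors of
  \<open>B\<close> have their contents inside one finitely generated ideal contained in \<open>Z(S)\<close>, which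
  gives Property (A) for \<open>B\<close>. Finally, if \<open>B\<close> is primal and every finitely generated ideal
  of \<open>S\<close> is a content \<open>c f\<close>, then an ideal \<open>c f \<subseteq> Z(S)\<close> puts \<open>f\<close> into \<open>Z(S)B = Z(B)\<close>, and the
  McCoy theorem for \<open>f\<close> provides the annihilator that Property (A) of \<open>S\<close> asks for.
\<close>

section \<open>Ideals of a commutative semiring\<close>

lemma semiring_ideal_zero:
  assumes "semiring_ideal I" shows "0 \<in> I"
proof -
  obtain a where "a \<in> I" using assms by (auto simp: semiring_ideal_def)
  then have "0 * a \<in> I" using assms unfolding semiring_ideal_def by blast
  then show ?thesis by simp
qed

lemma semiring_ideal_add:
  "semiring_ideal I \<Longrightarrow> a \<in> I \<Longrightarrow> b \<in> I \<Longrightarrow> a + b \<in> I"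
  by (simp add: semiring_ideal_def)

lemma semiring_ideal_mult:
  "semiring_ideal I \<Longrightarrow> a \<in> I \<Longrightarrow> s * a \<in> I"
  by (simp add: semiring_ideal_def)

lemma semiring_ideal_sum:
  assumes "semiring_ideal I" and "\<And>i. i \<in> A \<Longrightarrow> h i \<in> I"
  shows "sum h A \<in> I"
  using assms(2)
  by (induction A rule: infinite_finite_induct)
    (auto intro: semiring_ideal_zero semiring_ideal_add assms(1))

lemma semiring_ideal_hull: "semiring_ideal (semiring_ideal hull A)"
  unfolding semiring_ideal_def [of "semiring_ideal hull A"]
proof (intro conjI ballI allI)
  have "0 \<in> semiring_ideal hull A"
    by (auto simp: hull_def intro: semiring_ideal_zero)
  then show "semiring_ideal hull A \<noteq> {}" by blast
qed (auto simp: hull_def intro: semiring_ideal_add semiring_ideal_mult)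

lemma semiring_ideal_annihilator: "semiring_ideal {x. s * x = 0}"
  by (auto simp: semiring_ideal_def distrib_left mult.left_commute intro: exI [of _ 0])

text \<open>
  The powers \<open>I\<^sup>k J\<close> start at \<open>I\<^sup>0 J \<supseteq> J \<noteq> 0\<close>, so a vanishing one is preceded by a last
  nonvanishing one, all of whose elements are killed by \<open>I\<close>. The induction descends from \<open>k\<close>
  to that last index.
\<close>

lemma nonzero_annihilator_of_power_prod:
  assumes "y \<in> J" and "y \<noteq> 0" and "ideal_prod (ideal_power I k) J \<subseteq> {0}"
  shows "\<exists>s. s \<noteq> 0 \<and> (\<forall>a\<in>I. s * a = 0)"
  using assms(3)
proof (induction k)
  case 0
  have "(\<Sum>i<Suc 0. 1 * y) \<in> ideal_prod (ideal_power I 0) J"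
    unfolding ideal_prod_def using assms(1)
    by (intro CollectI exI [of _ "Suc 0"] exI [of _ "\<lambda>_. 1"] exI [of _ "\<lambda>_. y"]) auto
  with 0 assms(2) show ?case by auto
next
  case (Suc k)
  show ?case
  proof (cases "ideal_prod (ideal_power I k) J \<subseteq> {0}")
    case True
    then show ?thesis by (rule Suc.IH)
  next
    case False
    then obtain s where "s \<noteq> 0" and "s \<in> ideal_prod (ideal_power I k) J"
      by auto
    then obtain n :: nat and p q where s: "s = (\<Sum>i<n. p i * q i)"
      and p: "\<forall>i<n. p i \<in> ideal_power I k" and q: "\<forall>i<n. q i \<in> J"
      by (auto simp: ideal_prod_def)
    have "s * a = 0" if "a \<in> I" for a
    proof -
      have "a * p i \<in> ideal_power I (Suc k)" if "i < n" for i
      proof -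
        have "(\<Sum>j<Suc 0. a * p i) \<in> ideal_prod I (ideal_power I k)"
          unfolding ideal_prod_def using \<open>a \<in> I\<close> p that
          by (intro CollectI exI [of _ "Suc 0"] exI [of _ "\<lambda>_. a"] exI [of _ "\<lambda>_. p i"]) auto
        then show ?thesis by simp
      qed
      then have "(\<Sum>i<n. (a * p i) * q i) \<in> ideal_prod (ideal_power I (Suc k)) J"
        unfolding ideal_prod_def using q
        by (intro CollectI exI [of _ n] exI [of _ "\<lambda>i. a * p i"] exI [of _ q]) auto
      moreover have "s * a = (\<Sum>i<n. (a * p i) * q i)"
        by (simp add: s sum_distrib_left mult.commute [of _ a] mult.assoc)
      ultimately show ?thesis using Suc.prems by auto
    qed
    with \<open>s \<noteq> 0\<close> show ?thesis by blast
  qed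
qed

section \<open>Extension of ideals along the structure map\<close>

lemma semiring_ideal_ideal_ext:
  assumes "semiring_ideal I"
  shows "semiring_ideal (ideal_ext lam I)"
  unfolding semiring_ideal_def
proof (intro conjI ballI allI)
  show "ideal_ext lam I \<noteq> {}"
    unfolding ideal_ext_def by (auto intro: exI [of _ 0])
next
  fix x y
  assume "x \<in> ideal_ext lam I" and "y \<in> ideal_ext lam I"
  then obtain n m :: nat and a b f g
    where x: "x = (\<Sum>i<n. lam (a i) * f i)" and a: "\<forall>i<n. a i \<in> I"
      and y: "y = (\<Sum>i<m. lam (b i) * g i)" and b: "\<forall>i<m. b i \<in> I"
    unfolding ideal_ext_def by blast
  let ?a = "\<lambda>i. if i < n then a i else b (i - n)"
  let ?f = "\<lambda>i. if i < n then f i else g (i - n)"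
  have "(\<Sum>i<n+m. lam (?a i) * ?f i)
      = (\<Sum>i<n. lam (?a i) * ?f i) + (\<Sum>i<m. lam (?a (n + i)) * ?f (n + i))"
    by (induction m) (simp_all add: add.assoc)
  then have "x + y = (\<Sum>i<n+m. lam (?a i) * ?f i)"
    by (simp add: x y)
  moreover have "\<forall>i<n+m. ?a i \<in> I" using a b by auto
  ultimately show "x + y \<in> ideal_ext lam I"
    unfolding ideal_ext_def
    by (intro CollectI exI [of _ "n + m"] exI [of _ ?a] exI [of _ ?f] conjI)
next
  fix s x
  assume "x \<in> ideal_ext lam I"
  then obtain n :: nat and a f
    where x: "x = (\<Sum>i<n. lam (a i) * f i)" and a: "\<forall>i<n. a i \<in> I"
    unfolding ideal_ext_def by blast
  have "s * x = (\<Sum>i<n. lam (a i) * (s * f i))"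
    by (simp add: x sum_distrib_left mult.left_commute)
  with a show "s * x \<in> ideal_ext lam I"
    unfolding ideal_ext_def
    by (intro CollectI exI [of _ n] exI [of _ a] exI [of _ "\<lambda>i. s * f i"]) auto
qed

lemma ideal_ext_subset:
  assumes "semiring_ideal J" and "lam ` I \<subseteq> J"
  shows "ideal_ext lam I \<subseteq> J"
proof
  fix x
  assume "x \<in> ideal_ext lam I"
  then obtain n :: nat and a f
    where x: "x = (\<Sum>i<n. lam (a i) * f i)" and a: "\<forall>i<n. a i \<in> I"
    unfolding ideal_ext_def by blast
  have "lam (a i) * f i \<in> J" if "i < n" for i
  proof -
    have "f i * lam (a i) \<in> J"
      using a assms that by (blast intro: semiring_ideal_mult)
    then show ?thesis by (simp add: mult.commute)
  qed
  with assms(1) show "x \<in> J" unfolding x by (auto intro: semiring_ideal_sum)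
qed

section \<open>Zero-divisors of a content semialgebra\<close>

context content_semialgebra
begin

lemma semiring_ideal_content: "semiring_ideal (c f)"
  using content_ideal by (simp add: Id_set_def)

lemma mem_ideal_ext_iff:
  "semiring_ideal I \<Longrightarrow> f \<in> ideal_ext lam I \<longleftrightarrow> c f \<subseteq> I"
  using content_iff by (simp add: Id_set_def)

lemma content_zero: "c 0 = {0}"
proof -
  have "c 0 = (\<lambda>a. 0 * a) ` c 0"
    using content_scale [of 0 0] by (simp add: lam_zero)
  then show ?thesis
    using semiring_ideal_zero [OF semiring_ideal_content] by auto
qed

lemma content_eq_zero_iff: "c f \<subseteq> {0} \<longleftrightarrow> f = 0"
proof
  assume sub: "c f \<subseteq> {0}"
  have "semiring_ideal {0 :: 'a}" by (simp add: semiring_ideal_def)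
  with sub have "f \<in> ideal_ext lam {0}" by (simp add: mem_ideal_ext_iff)
  then show "f = 0" by (auto simp: ideal_ext_def lam_zero)
qed (simp add: content_zero)

lemma lam_eq_zero_iff: "lam s = 0 \<longleftrightarrow> s = 0"
  using lam_inj lam_zero by (metis injD)

lemma scale_eq_zero_iff: "lam s * f = 0 \<longleftrightarrow> (\<forall>a\<in>c f. s * a = 0)"
  using content_eq_zero_iff [of "lam s * f"] by (auto simp: content_scale)

text \<open>
  The coefficients in one expression of \<open>f\<close> as an element of \<open>c(f)B\<close> generate an ideal \<open>I\<close> with
  \<open>I \<subseteq> c f\<close> and \<open>f \<in> IB\<close>; minimality of the content then gives \<open>c f \<subseteq> I\<close>.
\<close>

lemma content_finitely_generated: "\<exists>A. finite A \<and> c f = semiring_ideal hull A"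
proof -
  have "f \<in> ideal_ext lam (c f)"
    by (simp add: mem_ideal_ext_iff semiring_ideal_content)
  then obtain n :: nat and a h
    where f: "f = (\<Sum>i<n. lam (a i) * h i)" and a: "\<forall>i<n. a i \<in> c f"
    unfolding ideal_ext_def by blast
  let ?I = "semiring_ideal hull (a ` {..<n})"
  have "f \<in> ideal_ext lam ?I"
    unfolding ideal_ext_def using f hull_subset [of "a ` {..<n}" semiring_ideal] by blast
  then have "c f \<subseteq> ?I"
    by (simp add: mem_ideal_ext_iff semiring_ideal_hull)
  moreover have "?I \<subseteq> c f"
    using a by (intro hull_minimal semiring_ideal_content) auto
  ultimately show ?thesis by (intro exI [of _ "a ` {..<n}"]) auto
qed

text \<open>
  The McCoy property. Dedekind--Mertens with \<open>c (f g) = c 0 = 0\<close> makes \<open>c(f)\<^sup>m\<^sup>+\<^sup>1 c(g)\<close> vanish.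
\<close>

lemma zero_divisor_iff_content_annihilated:
  "f \<in> zero_divisors \<longleftrightarrow> (\<exists>s. s \<noteq> 0 \<and> (\<forall>a\<in>c f. s * a = 0))"
proof
  assume "f \<in> zero_divisors"
  then obtain g where "g \<noteq> 0" and fg: "f * g = 0" by (auto simp: zero_divisors_def)
  then obtain y where y: "y \<in> c g" "y \<noteq> 0"
    using content_eq_zero_iff [of g] by blast
  obtain m where "ideal_prod (ideal_power (c f) (m + 1)) (c g)
      = ideal_prod (ideal_power (c f) m) {0}"
    using dedekind_mertens [of f g] by (auto simp: fg content_zero)
  also have "\<dots> \<subseteq> {0}" by (auto simp: ideal_prod_def intro!: sum.neutral)
  finally show "\<exists>s. s \<noteq> 0 \<and> (\<forall>a\<in>c f. s * a = 0)"
    by (rule nonzero_annihilator_of_power_prod [OF y])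
next
  assume "\<exists>s. s \<noteq> 0 \<and> (\<forall>a\<in>c f. s * a = 0)"
  then obtain s where "s \<noteq> 0" and "lam s * f = 0" by (auto simp: scale_eq_zero_iff)
  then have "lam s \<noteq> 0" and "f * lam s = 0" by (simp_all add: lam_eq_zero_iff mult.commute)
  then show "f \<in> zero_divisors" by (auto simp: zero_divisors_def)
qed

lemma content_zero_divisor_subset:
  "f \<in> zero_divisors \<Longrightarrow> c f \<subseteq> zero_divisors"
  unfolding zero_divisor_iff_content_annihilated
  by (auto simp: zero_divisors_def) (metis mult.commute)

text \<open>
  Zero-divisors are contracted along \<open>lam\<close>: by the McCoy property a zero-divisor \<open>lam s\<close> is
  already killed by a nonzero scalar.
\<close>

lemma lam_zero_divisor_iff: "lam s \<in> zero_divisors \<longleftrightarrow> s \<in> zero_divisors"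
proof -
  have "(\<forall>a\<in>c (lam s). t * a = 0) \<longleftrightarrow> s * t = 0" for t
    using scale_eq_zero_iff [of t "lam s"] lam_eq_zero_iff [of "s * t"]
    by (simp add: lam_mult mult.commute)
  then show ?thesis
    by (simp add: zero_divisor_iff_content_annihilated) (simp add: zero_divisors_def)
qed

lemma primal_imp_primal_base:
  assumes "primal TYPE('b)"
  shows "primal TYPE('a)"
proof -
  have Z: "semiring_ideal (zero_divisors :: 'b set)" using assms by (simp add: primal_def)
  have "(0 :: 'a) \<in> zero_divisors"
    using semiring_ideal_zero [OF Z] lam_zero_divisor_iff [of 0] by (simp add: lam_zero)
  then have "semiring_ideal (zero_divisors :: 'a set)"
    using Z unfolding semiring_ideal_def
    by (auto simp: lam_zero_divisor_iff [symmetric] lam_add lam_mult)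
  then show ?thesis by (simp add: primal_def)
qed

lemma zero_divisors_subset_ideal_ext:
  assumes "primal TYPE('a)"
  shows "(zero_divisors :: 'b set) \<subseteq> ideal_ext lam zero_divisors"
  using assms by (auto simp: primal_def mem_ideal_ext_iff dest: content_zero_divisor_subset)

lemma primal_imp_zero_divisors_eq:
  assumes "primal TYPE('b)"
  shows "(zero_divisors :: 'b set) = ideal_ext lam zero_divisors"
proof
  show "(zero_divisors :: 'b set) \<subseteq> ideal_ext lam zero_divisors"
    using assms by (intro zero_divisors_subset_ideal_ext primal_imp_primal_base)
  show "ideal_ext lam zero_divisors \<subseteq> (zero_divisors :: 'b set)"
    using assms by (intro ideal_ext_subset) (auto simp: primal_def lam_zero_divisor_iff)
qed

lemma property_A_imp_zero_divisors_eq: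
  assumes "primal TYPE('a)" and "property_A TYPE('a)"
  shows "(zero_divisors :: 'b set) = ideal_ext lam zero_divisors"
proof
  show "(zero_divisors :: 'b set) \<subseteq> ideal_ext lam zero_divisors"
    using assms(1) by (rule zero_divisors_subset_ideal_ext)
  show "ideal_ext lam zero_divisors \<subseteq> (zero_divisors :: 'b set)"
  proof
    fix f
    assume "f \<in> ideal_ext lam zero_divisors"
    then have "c f \<subseteq> zero_divisors" using assms(1) by (simp add: primal_def mem_ideal_ext_iff)
    moreover have "c f \<in> FId_set" using content_finitely_generated by (auto simp: FId_set_def)
    ultimately show "f \<in> zero_divisors"
      using assms(2) by (auto simp: property_A_def zero_divisor_iff_content_annihilated)
  qed
qed

lemma property_A_imp_primal:
  assumes "primal TYPE('a)" and "property_A TYPE('a)"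
  shows "primal TYPE('b)"
  using assms(1) semiring_ideal_ideal_ext [of "zero_divisors :: 'a set" lam]
  by (simp add: primal_def property_A_imp_zero_divisors_eq [OF assms])

text \<open>
  For a finitely generated ideal \<open>(F) \<subseteq> Z(B)\<close>, the generators of the contents of all \<open>f \<in> F\<close>
  together generate an ideal inside \<open>Z(S)\<close>, because \<open>Z(S)\<close> is an ideal. A scalar that
  annihilates it kills every \<open>f \<in> F\<close>, hence all of \<open>(F)\<close>.
\<close>

lemma property_A_transfer:
  assumes "primal TYPE('a)" and "property_A TYPE('a)"
  shows "property_A TYPE('b)"
  unfolding property_A_def
proof (intro ballI impI)
  fix J :: "'b set"
  assume "J \<in> FId_set" and JZ: "J \<subseteq> zero_divisors"
  then obtain F where "finite F" and J: "J = semiring_ideal hull F"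
    by (auto simp: FId_set_def)
  obtain G where G: "\<And>f. finite (G f)" "\<And>f. c f = semiring_ideal hull G f"
    using content_finitely_generated by metis
  let ?I = "semiring_ideal hull (\<Union>f\<in>F. G f)"
  have content_sub: "c f \<subseteq> ?I" if "f \<in> F" for f
    unfolding G(2) using that by (intro hull_mono) blast
  have "?I \<subseteq> zero_divisors"
  proof (rule hull_minimal)
    show "(\<Union>f\<in>F. G f) \<subseteq> zero_divisors"
    proof (rule UN_least)
      fix f
      assume "f \<in> F"
      then have "f \<in> zero_divisors" using JZ hull_subset [of F semiring_ideal] J by blast
      then have "c f \<subseteq> zero_divisors" by (rule content_zero_divisor_subset)
      then show "G f \<subseteq> zero_divisors"
        using hull_subset [of "G f" semiring_ideal] unfolding G(2) by blast
    qed
    show "semiring_ideal (zero_divisors :: 'a set)" using assms(1) by (simp add: primal_def)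
  qed
  moreover have "?I \<in> FId_set" using \<open>finite F\<close> G(1) by (auto simp: FId_set_def)
  ultimately obtain s where "s \<noteq> 0" and s: "\<forall>a\<in>?I. s * a = 0"
    using assms(2) unfolding property_A_def by blast
  have "F \<subseteq> {x. lam s * x = 0}"
    using s content_sub by (auto simp: scale_eq_zero_iff)
  then have "J \<subseteq> {x. lam s * x = 0}"
    unfolding J by (intro hull_minimal semiring_ideal_annihilator)
  then show "\<exists>t. t \<noteq> 0 \<and> (\<forall>x\<in>J. t * x = 0)"
    using \<open>s \<noteq> 0\<close> by (auto simp: lam_eq_zero_iff intro!: exI [of _ "lam s"])
qed

lemma surjective_content_primal_imp_property_A:
  assumes "FId_set \<subseteq> range c" and "primal TYPE('b)"
  shows "property_A TYPE('a)"
  unfolding property_A_def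
proof (intro ballI impI)
  fix I :: "'a set"
  assume "I \<in> FId_set" and IZ: "I \<subseteq> zero_divisors"
  then obtain f where I: "I = c f" using assms(1) by auto
  have "f \<in> ideal_ext lam zero_divisors"
    using IZ primal_imp_primal_base [OF assms(2)] by (simp add: I primal_def mem_ideal_ext_iff)
  then have "f \<in> zero_divisors" by (simp add: primal_imp_zero_divisors_eq [OF assms(2)])
  then show "\<exists>s. s \<noteq> 0 \<and> (\<forall>a\<in>I. s * a = 0)"
    by (simp add: I zero_divisor_iff_content_annihilated)
qed

end

theorem theorem56:
  fixes lam :: "'a::comm_semiring_1 \<Rightarrow> 'b::comm_semiring_1" and c :: "'b \<Rightarrow> 'a set"
  assumes "content_semialgebra lam c"
  shows "(primal TYPE('b) \<longrightarrow>
            primal TYPE('a) \<and>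
            (zero_divisors :: 'b set) = ideal_ext lam (zero_divisors :: 'a set)) \<and>
         (primal TYPE('a) \<and> property_A TYPE('a) \<longrightarrow>
            primal TYPE('b) \<and> property_A TYPE('b) \<and>
            (zero_divisors :: 'b set) = ideal_ext lam (zero_divisors :: 'a set)) \<and>
         (range c = FId_set \<longrightarrow>
            (primal TYPE('b) \<longleftrightarrow> primal TYPE('a) \<and> property_A TYPE('a)))"
proof -
  interpret content_semialgebra lam c by (fact assms)
  show ?thesis
    using primal_imp_primal_base primal_imp_zero_divisors_eq property_A_imp_zero_divisors_eq
      property_A_imp_primal property_A_transfer surjective_content_primal_imp_property_A
    by blast
qed

end
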